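(* Let $P$ be a probability measure on $\mathcal{X}\times\mathcal{Y}$. Let $\ell:\Delta^C\times\mathcal{Y}\to\mathbb{R}$ be a continuous strictly proper loss and $T$ an invertible column-stochastic $C\times C$ matrix. Let $L$ be the $0$-$1$ loss. Then for every $\epsilon>0$ there exists $\delta>0$ such that for all $x\in\mathcal{X}$ and all $q\in\Delta^C$, $$\mathcal{C}_{\ell_T,P_T,x}(q)<\mathcal{C}^*_{\ell_T,P_T,x}+\delta\ \Longrightarrow\ \mathcal{C}_{L,P,x}(q)<\mathcal{C}^*_{L,P,x}+\epsilon.$$
   Context: $\mathcal{X}$ is a (measurable) feature space, $\mathcal{Y}=\{1,\dots,C\}$, $\Delta^C=\{p\in\mathbb{R}^C: p_i\ge 0\ \forall i,\ \sum_i p_i=1\}$. A regular conditional distribution $P(\cdot\mid x)$ of $Y$ given $X=x$ under $P$ is assumed to exist and is fixed; $\eta(x)=(P(1\mid x),\dots,P(C\mid x))^{tr}\in\Delta^C$. For a column-stochastic $T=(t_{i,j})$, $P_T$ is the law of $(X,\tilde Y)$, where $(X,Y,\tilde Y)$ has law $\bar P_T(\mathcal{A}\times\{i\}\times\{j\})=P(\mathcal{A}\times\{i\})\,t_{j,i}$; the conditional distribution $P_T(\cdot\mid x)$ of $\tilde Y$ given $X=x$ is $T\eta(x)$. For a loss $L:\Delta^C\times\mathcal{Y}\to\mathbb{R}$: inner risk $\mathcal{C}_{L,P,x}(q)=\mathbb{E}_{Y\sim P(\cdot\mid x)}L(q,Y)$ for $q\in\Delta^C$, and $\mathcal{C}^*_{L,P,x}=\inf_{q\in\Delta^C}\mathcal{C}_{L,P,x}(q)$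 (and likewise with $P_T$ in place of $P$). A loss $\ell$ is proper if $\mathcal{C}^*_{\ell,P,x}=\mathcal{C}_{\ell,P,x}(\eta(x))$ for all probability measures $P$ on $\mathcal{X}\times\mathcal{Y}$ and all $x$ (i.e. $q\mapsto\sum_c p_c\ell(q,c)$ is minimized over $\Delta^C$ at $q=p$, for every $p\in\Delta^C$); strictly proper if in addition this minimizer is always unique. It is continuous if $\ell(\cdot,c)$ is continuous on $\Delta^C$ for each $c$. The $0$-$1$ loss is $L(q,c)=\mathbf{1}_{c\neq\min\{\arg\max_j q_j\}}$. The forward correction loss is $\ell_T(q,c)=\ell(Tq,c)$. *)

theory Defs
  imports "HOL-Probability.Probability"
begin

text \<open>
  The label set \<open>{1, \<dots>, C}\<close> is a finite, linearly ordered type \<open>'c\<close>, so \<open>C = CARD('c)\<close> and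
  \<open>\<real>\<^sup>C\<close> is \<^typ>\<open>real ^ 'c\<close>.  The order is only used to break ties in the 0-1 loss.
  The feature space is the measurable space underlying a measure \<open>M\<close> (only \<open>space M\<close> and
  \<open>sets M\<close> matter).  Distributions on labels, in particular the conditional distributions
  \<open>P(\<cdot> | x)\<close>, are \<^typ>\<open>'c pmf\<close>.
\<close>

subsection \<open>The simplex and conditional distributions\<close>

definition prob_simplex :: "(real ^ 'c::finite) set" where
  "prob_simplex = {p. (\<forall>i. 0 \<le> p $ i) \<and> (\<Sum>i\<in>UNIV. p $ i) = 1}"

text \<open>\<open>prob_vec (\<kappa> x)\<close> is \<open>\<eta>(x)\<close>.\<close>

definition prob_vec :: "'c::finite pmf \<Rightarrow> real ^ 'c" where
  "prob_vec \<mu> = (\<chi> i. pmf \<mu> i)"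

lemma prob_vec_in_simplex: "prob_vec \<mu> \<in> prob_simplex"
proof -
  have "(\<Sum>i\<in>UNIV. pmf \<mu> i) = 1"
    by (rule sum_pmf_eq_1) auto
  then show ?thesis
    by (simp add: prob_simplex_def prob_vec_def)
qed

lemma prob_simplex_eq_range: "prob_simplex = range (prob_vec :: 'c::finite pmf \<Rightarrow> _)"
proof (intro equalityI subsetI)
  fix p :: "real ^ 'c"
  assume p: "p \<in> prob_simplex"
  have "(\<integral>\<^sup>+ i. ennreal (p $ i) \<partial>count_space UNIV) = (\<Sum>i\<in>UNIV. ennreal (p $ i))"
    by (rule nn_integral_count_space_finite) simp
  also have "\<dots> = ennreal (\<Sum>i\<in>UNIV. p $ i)"
    using p by (simp add: prob_simplex_def sum_ennreal)
  also have "\<dots> = 1"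
    using p by (simp add: prob_simplex_def)
  finally have "pmf (embed_pmf (\<lambda>i. p $ i)) i = p $ i" for i
    using p by (intro pmf_embed_pmf) (auto simp: prob_simplex_def)
  then have "prob_vec (embed_pmf (\<lambda>i. p $ i)) = p"
    by (simp add: prob_vec_def vec_eq_iff)
  then show "p \<in> range prob_vec"
    by (metis rangeI)
qed (auto simp: prob_vec_in_simplex)

definition regular_cond_dist ::
  "'x measure \<Rightarrow> ('x \<times> 'c) measure \<Rightarrow> ('x \<Rightarrow> 'c pmf) \<Rightarrow> bool" where
  "regular_cond_dist M P \<kappa> \<longleftrightarrow>
     (\<forall>i. (\<lambda>x. pmf (\<kappa> x) i) \<in> borel_measurable M) \<and>
     (\<forall>A\<in>sets M. \<forall>i. emeasure P (A \<times> {i}) = (\<integral>\<^sup>+x\<in>A. ennreal (pmf (\<kappa> x) i) \<partial>distr P M fst))"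

subsection \<open>Label noise\<close>

text \<open>The entry \<open>T $ j $ i\<close> is \<open>t\<^sub>j\<^sub>,\<^sub>i\<close>, the probability of observing \<open>j\<close> when the true label is \<open>i\<close>.\<close>

definition column_stochastic :: "real ^ 'c ^ 'c::finite \<Rightarrow> bool" where
  "column_stochastic T \<longleftrightarrow> (\<forall>i j. 0 \<le> T $ j $ i) \<and> (\<forall>i. (\<Sum>j\<in>UNIV. T $ j $ i) = 1)"

definition noisy_joint ::
  "real ^ 'c ^ 'c::finite \<Rightarrow> ('x \<times> 'c) measure \<Rightarrow> (('x \<times> 'c) \<times> 'c) measure" where
  "noisy_joint T P =
     density (P \<Otimes>\<^sub>M count_space UNIV) (\<lambda>((x, i), j). ennreal (T $ j $ i))"

definition noisy_measure ::
  "'x measure \<Rightarrow> real ^ 'c ^ 'c::finite \<Rightarrow> ('x \<times> 'c) measure \<Rightarrow> ('x \<times> 'c) measure" where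
  "noisy_measure M T P =
     distr (noisy_joint T P) (M \<Otimes>\<^sub>M count_space UNIV) (\<lambda>((x, i), j). (x, j))"

text \<open>
  The version \<open>T \<eta>(x)\<close> of the conditional distribution of the noisy label, defined for every \<open>x\<close>
  (not just almost everywhere); see \<open>prob_vec_noisy_cond\<close> and \<open>regular_cond_dist_noisy\<close> below.
\<close>

definition noisy_cond :: "real ^ 'c ^ 'c::finite \<Rightarrow> ('x \<Rightarrow> 'c pmf) \<Rightarrow> 'x \<Rightarrow> 'c pmf" where
  "noisy_cond T \<kappa> x = embed_pmf (\<lambda>j. (T *v prob_vec (\<kappa> x)) $ j)"

lemma column_stochastic_simplex:
  assumes "column_stochastic T" "p \<in> prob_simplex"
  shows "T *v p \<in> prob_simplex"
proof -
  have "(\<Sum>j\<in>UNIV. \<Sum>i\<in>UNIV. T $ j $ i * p $ i) = (\<Sum>i\<in>UNIV. \<Sum>j\<in>UNIV. T $ j $ i * p $ i)"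
    by (rule sum.swap)
  also have "\<dots> = (\<Sum>i\<in>UNIV. p $ i)"
    using assms(1) by (simp add: column_stochastic_def flip: sum_distrib_right)
  finally show ?thesis
    using assms
    by (auto simp: column_stochastic_def prob_simplex_def matrix_vector_mult_def intro!: sum_nonneg)
qed

lemma prob_vec_noisy_cond:
  assumes "column_stochastic T"
  shows "prob_vec (noisy_cond T \<kappa> x) = T *v prob_vec (\<kappa> x)"
proof -
  have "T *v prob_vec (\<kappa> x) \<in> prob_simplex"
    by (intro column_stochastic_simplex assms prob_vec_in_simplex)
  then obtain \<nu> where \<nu>: "T *v prob_vec (\<kappa> x) = prob_vec \<nu>"
    unfolding prob_simplex_eq_range by blast
  have "noisy_cond T \<kappa> x = embed_pmf (pmf \<nu>)"
    unfolding noisy_cond_def \<nu> by (rule arg_cong[where f = embed_pmf]) (simp add: prob_vec_def fun_eq_iff)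
  also have "\<dots> = \<nu>"
    by (metis type_definition.Rep_inverse[OF td_pmf_embed_pmf])
  finally show ?thesis
    by (simp add: \<nu>)
qed

context
  fixes M :: "'x measure" and P :: "('x \<times> 'c::finite) measure" and T :: "real ^ 'c ^ 'c"
  assumes sets_P [measurable_cong]: "sets P = sets (M \<Otimes>\<^sub>M count_space UNIV)"
begin

lemma noisy_density_measurable [measurable]:
  "(\<lambda>((x, i), j). ennreal (T $ j $ i)) \<in> borel_measurable (P \<Otimes>\<^sub>M count_space UNIV)"
proof -
  have "(\<lambda>z. ennreal (T $ snd z $ snd (fst z))) \<in> borel_measurable (P \<Otimes>\<^sub>M count_space UNIV)"
    by (rule measurable_compose_countable[where f = "\<lambda>j z. ennreal (T $ j $ snd (fst z))" and g = snd])
       measurable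
  then show ?thesis
    by (simp add: case_prod_beta')
qed

lemma emeasure_noisy_joint:
  assumes "B \<in> sets P"
  shows "emeasure (noisy_joint T P) (B \<times> {j}) = (\<integral>\<^sup>+z\<in>B. ennreal (T $ j $ snd z) \<partial>P)"
proof -
  interpret C: sigma_finite_measure "count_space (UNIV :: 'c set)"
    by (rule sigma_finite_measure_count_space_finite) simp
  have [measurable]: "B \<in> sets P" by fact
  have "emeasure (noisy_joint T P) (B \<times> {j}) =
      (\<integral>\<^sup>+w. (case w of ((x, i), j) \<Rightarrow> ennreal (T $ j $ i)) * indicator (B \<times> {j}) w
        \<partial>(P \<Otimes>\<^sub>M count_space UNIV))"
    unfolding noisy_joint_def by (subst emeasure_density) (measurable, simp add: case_prod_beta')
  also have "\<dots> = (\<integral>\<^sup>+z. \<integral>\<^sup>+k. ennreal (T $ k $ snd z) * indicator (B \<times> {j}) (z, k)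
        \<partial>count_space UNIV \<partial>P)"
    by (subst C.nn_integral_fst[symmetric]) (measurable, simp add: case_prod_beta')
  also have "\<dots> = (\<integral>\<^sup>+z\<in>B. ennreal (T $ j $ snd z) \<partial>P)"
    by (intro nn_integral_cong)
       (simp add: nn_integral_count_space_finite indicator_times
          mult.assoc[symmetric] sum.delta split: split_indicator)
  finally show ?thesis .
qed

lemma emeasure_noisy_joint_rect:
  assumes "A \<in> sets M"
  shows "emeasure (noisy_joint T P) ((A \<times> {i}) \<times> {j}) = emeasure P (A \<times> {i}) * ennreal (T $ j $ i)"
proof -
  have [measurable]: "A \<times> {i} \<in> sets P"
    using assms by (simp add: sets_P)
  have "emeasure (noisy_joint T P) ((A \<times> {i}) \<times> {j}) =
      (\<integral>\<^sup>+z\<in>A \<times> {i}. ennreal (T $ j $ snd z) \<partial>P)"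
    by (rule emeasure_noisy_joint) measurable
  also have "\<dots> = (\<integral>\<^sup>+z. ennreal (T $ j $ i) * indicator (A \<times> {i}) z \<partial>P)"
    by (intro nn_integral_cong) (auto split: split_indicator)
  also have "\<dots> = ennreal (T $ j $ i) * emeasure P (A \<times> {i})"
    by (rule nn_integral_cmult_indicator) measurable
  finally show ?thesis
    by (simp add: mult.commute)
qed

lemma emeasure_noisy_measure:
  assumes "A \<in> sets M"
  shows "emeasure (noisy_measure M T P) (A \<times> {j}) =
           (\<Sum>i\<in>UNIV. emeasure P (A \<times> {i}) * ennreal (T $ j $ i))"
proof -
  have sets_joint [measurable_cong]:
    "sets (noisy_joint T P) = sets ((M \<Otimes>\<^sub>M count_space UNIV) \<Otimes>\<^sub>M count_space UNIV)"
    unfolding noisy_joint_def sets_density by (intro sets_pair_measure_cong sets_P refl)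
  have space_joint: "space (noisy_joint T P) = (space M \<times> UNIV) \<times> UNIV"
    using sets_eq_imp_space_eq[OF sets_joint] by (simp add: space_pair_measure)
  have [measurable]: "A \<in> sets M" by fact
  have A: "A \<subseteq> space M"
    using assms by (rule sets.sets_into_space)
  have "emeasure (noisy_measure M T P) (A \<times> {j}) =
      emeasure (noisy_joint T P) ((\<lambda>((x, i), j). (x, j)) -` (A \<times> {j}) \<inter> space (noisy_joint T P))"
    unfolding noisy_measure_def
  proof (rule emeasure_distr)
    have "(\<lambda>z. (fst (fst z), snd z)) \<in> noisy_joint T P \<rightarrow>\<^sub>M M \<Otimes>\<^sub>M count_space (UNIV :: 'c set)"
      by measurable
    then show "(\<lambda>((x, i), j). (x, j)) \<in> noisy_joint T P \<rightarrow>\<^sub>M M \<Otimes>\<^sub>M count_space (UNIV :: 'c set)"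
      by (simp add: case_prod_beta')
  qed (simp add: assms)
  also have "(\<lambda>((x, i), j). (x, j)) -` (A \<times> {j}) \<inter> space (noisy_joint T P) =
      (\<Union>i\<in>UNIV. (A \<times> {i}) \<times> {j})"
    using A by (auto simp: space_joint)
  also have "emeasure (noisy_joint T P) \<dots> =
      (\<Sum>i\<in>UNIV. emeasure (noisy_joint T P) ((A \<times> {i}) \<times> {j}))"
    by (rule sum_emeasure[symmetric]) (auto simp: disjoint_family_on_def sets_joint assms)
  finally show ?thesis
    by (simp add: emeasure_noisy_joint_rect assms)
qed

lemma sets_noisy_measure [simp]: "sets (noisy_measure M T P) = sets (M \<Otimes>\<^sub>M count_space UNIV)"
  by (simp add: noisy_measure_def)

lemma emeasure_times_UNIV:
  fixes Q :: "('x \<times> 'c) measure"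
  assumes "sets Q = sets (M \<Otimes>\<^sub>M count_space UNIV)" "A \<in> sets M"
  shows "emeasure Q (A \<times> UNIV) = (\<Sum>i\<in>UNIV. emeasure Q (A \<times> {i}))"
proof -
  have "A \<times> UNIV = (\<Union>i\<in>UNIV. A \<times> {i :: 'c})"
    by auto
  then show ?thesis
    by (simp only:) (rule sum_emeasure[symmetric], auto simp: disjoint_family_on_def assms)
qed

lemma noisy_measure_marginal:
  assumes "column_stochastic T"
  shows "distr (noisy_measure M T P) M fst = distr P M fst"
proof (rule measure_eqI)
  fix A assume "A \<in> sets (distr (noisy_measure M T P) M fst)"
  then have A [measurable]: "A \<in> sets M"
    by simp
  have marg: "emeasure (distr Q M fst) A = (\<Sum>i\<in>UNIV. emeasure Q (A \<times> {i}))"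
    if Q: "sets Q = sets (M \<Otimes>\<^sub>M count_space UNIV)" for Q :: "('x \<times> 'c) measure"
  proof -
    have [measurable_cong]: "sets Q = sets (M \<Otimes>\<^sub>M count_space UNIV)" by fact
    have "fst -` A \<inter> space Q = A \<times> UNIV"
      using sets.sets_into_space[OF A] sets_eq_imp_space_eq[OF Q] by (auto simp: space_pair_measure)
    then show ?thesis
      by (subst emeasure_distr) (measurable, simp add: emeasure_times_UNIV[OF Q A])
  qed
  have "(\<Sum>j\<in>UNIV. \<Sum>i\<in>UNIV. emeasure P (A \<times> {i}) * ennreal (T $ j $ i)) =
      (\<Sum>i\<in>UNIV. emeasure P (A \<times> {i}) * (\<Sum>j\<in>UNIV. ennreal (T $ j $ i)))"
    by (subst sum.swap) (simp add: sum_distrib_left)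
  also have "\<dots> = (\<Sum>i\<in>UNIV. emeasure P (A \<times> {i}))"
    using assms by (simp add: column_stochastic_def sum_ennreal)
  finally show "emeasure (distr (noisy_measure M T P) M fst) A = emeasure (distr P M fst) A"
    by (simp add: marg sets_P emeasure_noisy_measure A)
qed simp

lemma prob_space_noisy_measure:
  assumes "prob_space P" "column_stochastic T"
  shows "prob_space (noisy_measure M T P)"
proof -
  have [measurable]: "fst \<in> noisy_measure M T P \<rightarrow>\<^sub>M M" "fst \<in> P \<rightarrow>\<^sub>M M"
    by (simp_all add: noisy_measure_def sets_P cong: measurable_cong_sets)
  have "prob_space (distr P M fst)"
    by (intro prob_space.prob_space_distr assms) measurable
  then show ?thesis
    unfolding noisy_measure_marginal[OF assms(2), symmetric]
    by (rule prob_space_distrD[rotated]) measurable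
qed

lemma regular_cond_dist_noisy:
  assumes T: "column_stochastic T" and \<kappa>: "regular_cond_dist M P \<kappa>"
  shows "regular_cond_dist M (noisy_measure M T P) (noisy_cond T \<kappa>)"
proof -
  have \<kappa>m [measurable]: "(\<lambda>x. pmf (\<kappa> x) i) \<in> borel_measurable M" for i
    using \<kappa> by (simp add: regular_cond_dist_def)
  have T0: "0 \<le> T $ j $ i" for i j
    using T by (simp add: column_stochastic_def)
  have pmf_noisy: "pmf (noisy_cond T \<kappa> x) j = (\<Sum>i\<in>UNIV. T $ j $ i * pmf (\<kappa> x) i)" for x j
    using prob_vec_noisy_cond[OF T, of \<kappa> x]
    by (simp add: prob_vec_def vec_eq_iff matrix_vector_mult_def)
  have "emeasure (noisy_measure M T P) (A \<times> {j}) =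
      (\<integral>\<^sup>+x\<in>A. ennreal (pmf (noisy_cond T \<kappa> x) j) \<partial>distr (noisy_measure M T P) M fst)"
    if A [measurable]: "A \<in> sets M" for A j
  proof -
    have "emeasure (noisy_measure M T P) (A \<times> {j}) =
        (\<Sum>i\<in>UNIV. (\<integral>\<^sup>+x\<in>A. ennreal (pmf (\<kappa> x) i) \<partial>distr P M fst) * ennreal (T $ j $ i))"
      using \<kappa> by (simp add: emeasure_noisy_measure regular_cond_dist_def A)
    also have "\<dots> = (\<Sum>i\<in>UNIV. \<integral>\<^sup>+x. ennreal (pmf (\<kappa> x) i) * indicator A x * ennreal (T $ j $ i)
        \<partial>distr P M fst)"
      by (intro sum.cong refl nn_integral_multc[symmetric]) measurable
    also have "\<dots> = (\<integral>\<^sup>+x. (\<Sum>i\<in>UNIV. ennreal (pmf (\<kappa> x) i) * indicator A x * ennreal (T $ j $ i))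
        \<partial>distr P M fst)"
      by (rule nn_integral_sum[symmetric]) measurable
    also have "\<dots> = (\<integral>\<^sup>+x\<in>A. ennreal (pmf (noisy_cond T \<kappa> x) j) \<partial>distr P M fst)"
      by (intro nn_integral_cong)
         (simp add: pmf_noisy T0 ennreal_mult sum_ennreal[symmetric] mult.commute
           split: split_indicator)
    finally show ?thesis
      by (simp add: noisy_measure_marginal[OF T])
  qed
  then show ?thesis
    by (simp add: regular_cond_dist_def pmf_noisy)
qed

end

subsection \<open>Losses and inner risks\<close>

text \<open>
  A loss on \<open>\<Delta>\<^sup>C\<close> is a function on all of \<^typ>\<open>real ^ 'c\<close> of which only the values on
  \<^const>\<open>prob_simplex\<close> are used.
\<close>

type_synonym 'c loss = "real ^ 'c \<Rightarrow> 'c \<Rightarrow> real"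

text \<open>
  With \<open>\<mu> = P(\<cdot> | x)\<close>, the next two are \<open>\<C>\<^bsub>L,P,x\<^esub>(q)\<close> and \<open>\<C>\<^sup>*\<^bsub>L,P,x\<^esub>\<close>.  The real infimum is
  meaningful for losses that are bounded below on the simplex; that covers the 0-1 loss and all
  losses that are continuous there (and their forward corrections).
\<close>

definition inner_risk :: "'c::finite loss \<Rightarrow> 'c pmf \<Rightarrow> real ^ 'c \<Rightarrow> real" where
  "inner_risk L \<mu> q = measure_pmf.expectation \<mu> (\<lambda>c. L q c)"

definition opt_inner_risk :: "'c::finite loss \<Rightarrow> 'c pmf \<Rightarrow> real" where
  "opt_inner_risk L \<mu> = (INF q\<in>prob_simplex. inner_risk L \<mu> q)"

text \<open>By \<open>prob_simplex_eq_range\<close>, \<open>prob_vec \<mu>\<close> ranges over the whole simplex.\<close>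

definition proper_loss :: "'c::finite loss \<Rightarrow> bool" where
  "proper_loss l \<longleftrightarrow> (\<forall>\<mu>. is_arg_min (inner_risk l \<mu>) (\<lambda>q. q \<in> prob_simplex) (prob_vec \<mu>))"

definition strictly_proper_loss :: "'c::finite loss \<Rightarrow> bool" where
  "strictly_proper_loss l \<longleftrightarrow>
     proper_loss l \<and>
     (\<forall>\<mu> q. is_arg_min (inner_risk l \<mu>) (\<lambda>q. q \<in> prob_simplex) q \<longrightarrow> q = prob_vec \<mu>)"

definition continuous_loss :: "'c::finite loss \<Rightarrow> bool" where
  "continuous_loss l \<longleftrightarrow> (\<forall>c. continuous_on prob_simplex (\<lambda>q. l q c))"

definition zero_one_loss :: "'c::{finite, linorder} loss" where
  "zero_one_loss q c = of_bool (c \<noteq> Min {j. \<forall>k. q $ k \<le> q $ j})"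

definition forward_loss :: "real ^ 'c ^ 'c \<Rightarrow> 'c::finite loss \<Rightarrow> 'c loss" where
  "forward_loss T l q c = l (T *v q) c"

end

theory Submission
  imports Defs
begin

text \<open>
  The excess risk of \<open>\<ell>\<close> at \<open>T p\<close>, evaluated in \<open>T q\<close>, is a continuous function of \<open>(p, q)\<close> that
  vanishes only for \<open>T q = T p\<close>, i.e. on the diagonal.  By compactness of \<open>\<Delta>\<^sup>C \<times> \<Delta>\<^sup>C\<close> it is bounded
  away from \<open>0\<close> off any neighbourhood of the diagonal, so a small excess risk forces \<open>q\<close> to be
  uniformly close to \<open>p = \<eta>(x)\<close>.  The 0-1 regret is at most \<open>2 \<parallel>p - q\<parallel>\<close>.
\<close>

lemma inner_risk_eq_sum: "inner_risk L \<mu> q = (\<Sum>c\<in>UNIV. prob_vec \<mu> $ c * L q c)"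
  unfolding inner_risk_def by (subst integral_measure_pmf[of UNIV]) (auto simp: prob_vec_def)

lemma compact_prob_simplex: "compact (prob_simplex :: (real ^ 'c::finite) set)"
proof -
  have "closed {p :: real ^ 'c. (\<forall>i. 0 \<le> p $ i) \<and> (\<Sum>i\<in>UNIV. p $ i) = 1}"
    by (intro closed_Collect_conj closed_Collect_all closed_Collect_le closed_Collect_eq
        continuous_intros)
  moreover have "norm p \<le> 1" if "p \<in> prob_simplex" for p :: "real ^ 'c"
    using norm_le_l1_cart[of p] that by (simp add: prob_simplex_def)
  then have "bounded (prob_simplex :: (real ^ 'c) set)"
    by (rule boundedI)
  ultimately show ?thesis
    by (simp add: compact_eq_bounded_closed prob_simplex_def)
qed

lemma proper_loss_inner_risk_le:
  assumes "proper_loss l" "q \<in> prob_simplex"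
  shows "inner_risk l \<mu> (prob_vec \<mu>) \<le> inner_risk l \<mu> q"
  using assms by (auto simp: proper_loss_def is_arg_min_linorder)

text \<open>A point of the simplex whose risk does not exceed the minimum would be a second
  minimizer, against uniqueness.\<close>

lemma strictly_proper_loss_inner_risk_less:
  assumes l: "strictly_proper_loss l" and q: "q \<in> prob_simplex" "q \<noteq> prob_vec \<mu>"
  shows "inner_risk l \<mu> (prob_vec \<mu>) < inner_risk l \<mu> q"
proof (rule ccontr)
  assume "\<not> ?thesis"
  then have "is_arg_min (inner_risk l \<mu>) (\<lambda>q. q \<in> prob_simplex) q"
    using l q(1) proper_loss_inner_risk_le[of l _ \<mu>]
    by (force simp: strictly_proper_loss_def is_arg_min_linorder)
  then show False
    using l q(2) by (simp add: strictly_proper_loss_def)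
qed

lemma inner_risk_forward_loss: "inner_risk (forward_loss T l) \<mu> q = inner_risk l \<mu> (T *v q)"
  by (simp add: inner_risk_def forward_loss_def)

text \<open>The correction restricts predictions to the image of the simplex under \<open>T\<close>,
  but the unrestricted minimizer, the noisy conditional distribution, lies in that image. So the
  infimum is attained at the clean distribution.\<close>

lemma opt_inner_risk_forward_loss:
  assumes l: "proper_loss l" and T: "column_stochastic T"
  shows "opt_inner_risk (forward_loss T l) (noisy_cond T \<kappa> x) =
           inner_risk l (noisy_cond T \<kappa> x) (T *v prob_vec (\<kappa> x))"
  unfolding opt_inner_risk_def inner_risk_forward_loss
proof (rule cInf_eq_minimum)
  fix r
  assume "r \<in> (\<lambda>q. inner_risk l (noisy_cond T \<kappa> x) (T *v q)) ` prob_simplex"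
  then show "inner_risk l (noisy_cond T \<kappa> x) (T *v prob_vec (\<kappa> x)) \<le> r"
    using proper_loss_inner_risk_le[OF l column_stochastic_simplex[OF T], of _ "noisy_cond T \<kappa> x"]
    by (auto simp: prob_vec_noisy_cond[OF T])
qed (simp add: prob_vec_in_simplex)

text \<open>Predicting label \<open>j\<close> costs \<open>1 - p $ j\<close>. The label chosen from
  \<open>q\<close> maximizes \<open>q\<close>, so it nearly maximizes \<open>p\<close> when the two
  vectors are close.\<close>

lemma zero_one_regret_le:
  fixes \<mu> :: "'c::{finite, linorder} pmf"
  shows "inner_risk zero_one_loss \<mu> q \<le> opt_inner_risk zero_one_loss \<mu> + 2 * dist (prob_vec \<mu>) q"
proof -
  let ?p = "prob_vec \<mu>"
  define j where "j q = Min {j :: 'c. \<forall>k. (q :: (real, 'c) vec) $ k \<le> q $ j}" for q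
  have risk: "inner_risk zero_one_loss \<mu> q = 1 - ?p $ j q" for q
  proof -
    have "inner_risk zero_one_loss \<mu> q = (\<Sum>c\<in>UNIV. ?p $ c - (if c = j q then ?p $ c else 0))"
      unfolding inner_risk_eq_sum zero_one_loss_def j_def[symmetric] by (rule sum.cong) auto
    also have "\<dots> = 1 - ?p $ j q"
      using prob_vec_in_simplex[of \<mu>] by (simp add: sum_subtractf prob_simplex_def)
    finally show ?thesis .
  qed
  \<comment> \<open>The set of maximizers must be shown nonempty before \<open>Min\<close> is known
    to pick one of them.\<close>
  have j: "q $ k \<le> q $ j q" for q k
  proof -
    have "Max (range (($) q)) \<in> range (($) q)"
      by (rule Max_in) auto
    then obtain i where "q $ i = Max (range (($) q))"
      by force
    then have "i \<in> {j. \<forall>k. q $ k \<le> q $ j}"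
      by simp
    then have "j q \<in> {j. \<forall>k. q $ k \<le> q $ j}"
      unfolding j_def by (intro Min_in) auto
    then show ?thesis
      by simp
  qed
  have "\<bar>?p $ k - q $ k\<bar> \<le> dist ?p q" for k
    using component_le_norm_cart[of "?p - q" k] by (simp add: dist_norm)
  \<comment> \<open>The factor 2 arises from passing from \<open>p\<close> to \<open>q\<close> at
    \<open>j ?p\<close> and back at \<open>j q\<close>.\<close>
  from this[of "j ?p"] this[of "j q"] have "1 - ?p $ j q - 2 * dist ?p q \<le> 1 - ?p $ j ?p"
    using j[of q "j ?p"] by linarith
  also have "\<dots> \<le> opt_inner_risk zero_one_loss \<mu>"
    unfolding opt_inner_risk_def risk using j[of ?p] prob_vec_in_simplex
    by (intro cINF_greatest) auto
  finally show ?thesis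
    by (simp add: risk)
qed

text \<open>The bound \<delta> is fixed before \<kappa> and \<open>x\<close>: compactness ranges
  over all pairs of distributions, so uniformity in \<open>x\<close> comes for free.\<close>

lemma inner_risk_forward_loss_close:
  fixes l :: "'c::finite loss" and T :: "real ^ 'c ^ 'c" and r :: real
  assumes cont: "continuous_loss l" and l: "strictly_proper_loss l"
    and T: "column_stochastic T" "invertible T" and r: "0 < r"
  obtains \<delta> where "0 < \<delta>"
    and "\<And>\<kappa> x q. q \<in> prob_simplex \<Longrightarrow>
      inner_risk (forward_loss T l) (noisy_cond T \<kappa> x) q
        < opt_inner_risk (forward_loss T l) (noisy_cond T \<kappa> x) + \<delta> \<Longrightarrow>
      dist (prob_vec (\<kappa> x)) q < r"
proof -
  \<comment> \<open>Writing the optimal risk as the risk at \<open>T *v p\<close> makes continuity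
    in \<open>p\<close> visible, with no infimum left.\<close>
  define g where "g = (\<lambda>(p, q). (\<Sum>c\<in>UNIV. (T *v p) $ c * (l (T *v q) c - l (T *v p) c)))"
  define K :: "((real ^ 'c) \<times> (real ^ 'c)) set"
    where "K = (prob_simplex \<times> prob_simplex) \<inter> {z. r \<le> dist (fst z) (snd z)}"
  have g: "g (prob_vec (\<kappa> x), q) = inner_risk (forward_loss T l) (noisy_cond T \<kappa> x) q
      - opt_inner_risk (forward_loss T l) (noisy_cond T \<kappa> x)" for \<kappa> :: "'d \<Rightarrow> 'c pmf" and x q
    using l T(1)
    by (simp add: g_def opt_inner_risk_forward_loss strictly_proper_loss_def
        inner_risk_eq_sum forward_loss_def prob_vec_noisy_cond right_diff_distrib sum_subtractf)
  have pos: "0 < g z" if zK: "z \<in> K" for z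
  proof -
    obtain p q where z: "z = (p, q)" "p \<in> prob_simplex" "q \<in> prob_simplex" "p \<noteq> q"
      using zK r by (cases z) (force simp: K_def)
    obtain \<mu> where \<mu>: "prob_vec \<mu> = T *v p"
      using column_stochastic_simplex[OF T(1) z(2)] unfolding prob_simplex_eq_range by auto
    \<comment> \<open>Invertibility enters here: distinct predictions stay distinct under
      \<open>T\<close>.\<close>
    have "T *v q \<noteq> prob_vec \<mu>"
      using z(4) inj_matrix_vector_mult[OF T(2)] by (auto simp: \<mu> dest: injD)
    from strictly_proper_loss_inner_risk_less[OF l column_stochastic_simplex[OF T(1) z(3)] this]
    show ?thesis
      by (simp add: z(1) g_def inner_risk_eq_sum \<mu> right_diff_distrib sum_subtractf)
  qed
  have "compact K"
    unfolding K_def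
    by (intro compact_Int_closed compact_Times compact_prob_simplex closed_Collect_le
        continuous_intros)
  moreover have "continuous_on K g"
  proof -
    have l': "continuous_on K (\<lambda>z. l (T *v f z) c)"
      if "continuous_on K f" "f ` K \<subseteq> prob_simplex" for c f
      using cont that column_stochastic_simplex[OF T(1)]
      by (intro continuous_on_compose2[of prob_simplex "\<lambda>q. l q c" K "\<lambda>z. T *v f z"]
          continuous_on_compose2[of UNIV "(*v) T" K f] matrix_vector_mult_linear_continuous_on)
         (auto simp: continuous_loss_def)
    show ?thesis
      unfolding g_def case_prod_beta'
      by (intro continuous_intros l' continuous_on_compose2[of UNIV "(*v) T"]
          matrix_vector_mult_linear_continuous_on) (auto simp: K_def)
  qed
  ultimately obtain \<delta> where \<delta>: "0 < \<delta>" "\<And>z. z \<in> K \<Longrightarrow> \<delta> \<le> g z"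
  \<comment> \<open>For large \<open>r\<close> no pair is that far apart and any positive \<delta>
    serves; otherwise the minimum of \<open>g\<close> over \<open>K\<close> does.\<close>
  proof (cases "K = {}")
    case False
    with \<open>compact K\<close> \<open>continuous_on K g\<close> obtain z where "z \<in> K" "\<And>y. y \<in> K \<Longrightarrow> g z \<le> g y"
      using continuous_attains_inf[of K g] by blast
    with pos that show ?thesis by blast
  qed (use zero_less_one in blast)
  show ?thesis
  proof (rule that[OF \<delta>(1)])
    fix \<kappa> :: "'d \<Rightarrow> 'c pmf" and x q
    assume q: "q \<in> prob_simplex"
      and "inner_risk (forward_loss T l) (noisy_cond T \<kappa> x) q
        < opt_inner_risk (forward_loss T l) (noisy_cond T \<kappa> x) + \<delta>"
    then have "g (prob_vec (\<kappa> x), q) < \<delta>"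
      by (simp add: g)
    then have "(prob_vec (\<kappa> x), q) \<notin> K"
      using \<delta>(2) leD by blast
    then show "dist (prob_vec (\<kappa> x)) q < r"
      using q by (auto simp: K_def prob_vec_in_simplex)
  qed
qed

theorem lemma15:
  fixes M :: "'x measure"
    and P :: "('x \<times> 'c::{finite, linorder}) measure"
    and \<kappa> :: "'x \<Rightarrow> 'c pmf"
    and l :: "'c loss"
    and T :: "real ^ ('c::{finite, linorder}) ^ ('c::{finite, linorder})"
  assumes "prob_space P"
    and "sets P = sets (M \<Otimes>\<^sub>M count_space UNIV)"
    and "regular_cond_dist M P \<kappa>"
    and "continuous_loss l"
    and "strictly_proper_loss l"
    and "column_stochastic T"
    and "invertible T"
  shows "\<forall>\<epsilon>>0. \<exists>\<delta>>0. \<forall>x\<in>space M. \<forall>q\<in>prob_simplex.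
           inner_risk (forward_loss T l) (noisy_cond T \<kappa> x) q
             < opt_inner_risk (forward_loss T l) (noisy_cond T \<kappa> x) + \<delta> \<longrightarrow>
           inner_risk zero_one_loss (\<kappa> x) q < opt_inner_risk zero_one_loss (\<kappa> x) + \<epsilon>"
proof (intro allI impI)
  fix \<epsilon> :: real
  assume "0 < \<epsilon>"
  \<comment> \<open>The radius \<epsilon> / 2 cancels the factor 2 in the 0-1 regret bound.\<close>
  then obtain \<delta> where "0 < \<delta>"
    and \<delta>: "\<And>(\<kappa> :: 'x \<Rightarrow> 'c pmf) x q. q \<in> prob_simplex \<Longrightarrow>
      inner_risk (forward_loss T l) (noisy_cond T \<kappa> x) q
        < opt_inner_risk (forward_loss T l) (noisy_cond T \<kappa> x) + \<delta> \<Longrightarrow>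
      dist (prob_vec (\<kappa> x)) q < \<epsilon> / 2"
    using inner_risk_forward_loss_close[OF assms(4-7), of "\<epsilon> / 2"] by (metis half_gt_zero)
  have "inner_risk zero_one_loss (\<kappa> x) q < opt_inner_risk zero_one_loss (\<kappa> x) + \<epsilon>"
    if "q \<in> prob_simplex" and "inner_risk (forward_loss T l) (noisy_cond T \<kappa> x) q
      < opt_inner_risk (forward_loss T l) (noisy_cond T \<kappa> x) + \<delta>" for x q
    using \<delta>[OF that] zero_one_regret_le[of "\<kappa> x" q] by linarith
  with \<open>0 < \<delta>\<close> show "\<exists>\<delta>>0. \<forall>x\<in>space M. \<forall>q\<in>prob_simplex.
      inner_risk (forward_loss T l) (noisy_cond T \<kappa> x) q
        < opt_inner_risk (forward_loss T l) (noisy_cond T \<kappa> x) + \<delta> \<longrightarrow>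
      inner_risk zero_one_loss (\<kappa> x) q < opt_inner_risk zero_one_loss (\<kappa> x) + \<epsilon>"
    by blast
qed

end
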